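(* Let $q$ be an odd prime power and let $\mathcal{S}$ be a set of mutually noncollinear points on $\mathsf{H}(3,q^2)$. Suppose there are four non-coplanar points $P,Q_1,Q_2,Q_3\in\mathcal{S}$ such that all triangles $PQ_iR$, with $i\in\{1,2,3\}$ and $R\in\mathcal{S}\setminus\{P,Q_i\}$, are in perspective. Then $|\mathcal{S}|\le q^2+1$, and equality holds if and only if $\mathcal{S}$ is equivalent under the collineation group of $\mathsf{H}(3,q^2)$ to the Hermitian Veronesean $\mathcal{V}$.
   Context: Points of $\mathrm{PG}(3,q^2)$ are given by homogeneous coordinates $(X_0,X_1,X_2,X_3)$ over $\mathbb{F}_{q^2}$. Let $h(X,Y)=X_0Y_3^q+X_3Y_0^q-X_1Y_1^q-X_2Y_2^q$, and let $\mathsf{H}(3,q^2)$ be the associated Hermitian surface, i.e. the set of points $X$ with $h(X,X)=0$. Two points $X,Y$ of $\mathsf{H}(3,q^2)$ are called collinear if $h(X,Y)=0$ (for distinct points: the line $XY$ is contained in $\mathsf{H}(3,q^2)$); "mutually noncollinear" means that no two distinct points of the set are collinear. Let $\perp$ be the polarity of $\mathrm{PG}(3,q^2)$ defined by $h$. Three pairwise noncollinear points $A,B,C$ of $\mathsf{H}(3,q^2)$ are in perspective (the triangle $ABC$ is in perspective) if the planes $\langle A^\perp\cap B^\perp,C\rangle$, $\langle B^\perp\cap C^\perp,A\rangle$, $\langle C^\perp\cap A^\perp,B\rangle$ intersect in a line. The collineation group of $\mathsf{H}(3,q^2)$ is $\mathrm{P\Gamma U}(4,q)$, the group of all collineations of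 $\mathrm{PG}(3,q^2)$ (induced by semilinear maps) that stabilise $\mathsf{H}(3,q^2)$. The Hermitian Veronesean is $\mathcal{V}=\{(1,x,x^q,x^{q+1}):x\in\mathbb{F}_{q^2}\}\cup\{(0,0,0,1)\}$. "Non-coplanar" means not contained in a common plane of $\mathrm{PG}(3,q^2)$. *)

theory Defs
  imports "HOL-Analysis.Analysis" "HOL-Number_Theory.Prime_Powers"
begin

text \<open>
  The field with \<open>q\<^sup>2\<close> elements is a type \<open>'a :: {field, finite}\<close> with \<open>CARD('a) = q\<^sup>2\<close>, and a
  subspace of \<open>PG(3,q\<^sup>2)\<close> is the corresponding set of vectors (a linear subspace) of \<open>'a ^ 4\<close>.
  The coordinates are indexed by \<open>0, 1, 2, 3 :: 4\<close>.
\<close>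

definition coords4 :: "'a \<Rightarrow> 'a \<Rightarrow> 'a \<Rightarrow> 'a \<Rightarrow> 'a ^ 4" where
  "coords4 a b c d = (\<chi> i. if i = 0 then a else if i = 1 then b else if i = 2 then c else d)"

definition pg_points :: "('a::field ^ 4) set set" where
  "pg_points = {X. vec.subspace X \<and> vec.dim X = 1}"

definition pg_lines :: "('a::field ^ 4) set set" where
  "pg_lines = {L. vec.subspace L \<and> vec.dim L = 2}"

definition pg_planes :: "('a::field ^ 4) set set" where
  "pg_planes = {E. vec.subspace E \<and> vec.dim E = 3}"

definition pg_coplanar :: "('a::field ^ 4) set set \<Rightarrow> bool" where
  "pg_coplanar T \<longleftrightarrow> (\<exists>E\<in>pg_planes. \<forall>X\<in>T. X \<subseteq> E)"

definition herm_form :: "nat \<Rightarrow> 'a::field ^ 4 \<Rightarrow> 'a ^ 4 \<Rightarrow> 'a" where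
  "herm_form q x y =
     x $ 0 * (y $ 3) ^ q + x $ 3 * (y $ 0) ^ q - x $ 1 * (y $ 1) ^ q - x $ 2 * (y $ 2) ^ q"

definition herm_surface :: "nat \<Rightarrow> ('a::field ^ 4) set set" where
  "herm_surface q = {X \<in> pg_points. \<forall>x\<in>X. herm_form q x x = 0}"

definition herm_collinear :: "nat \<Rightarrow> ('a::field ^ 4) set \<Rightarrow> ('a ^ 4) set \<Rightarrow> bool" where
  "herm_collinear q X Y \<longleftrightarrow> (\<forall>x\<in>X. \<forall>y\<in>Y. herm_form q x y = 0)"

definition perp :: "nat \<Rightarrow> ('a::field ^ 4) set \<Rightarrow> ('a ^ 4) set" where
  "perp q U = {y. \<forall>x\<in>U. herm_form q x y = 0}"

definition in_perspective ::
    "nat \<Rightarrow> ('a::field ^ 4) set \<Rightarrow> ('a ^ 4) set \<Rightarrow> ('a ^ 4) set \<Rightarrow> bool" where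
  "in_perspective q A B C \<longleftrightarrow>
     vec.span ((perp q A \<inter> perp q B) \<union> C)
     \<inter> vec.span ((perp q B \<inter> perp q C) \<union> A)
     \<inter> vec.span ((perp q C \<inter> perp q A) \<union> B) \<in> pg_lines"

definition field_automorphism :: "('a::field \<Rightarrow> 'a) \<Rightarrow> bool" where
  "field_automorphism \<sigma> \<longleftrightarrow>
     bij \<sigma> \<and> (\<forall>a b. \<sigma> (a + b) = \<sigma> a + \<sigma> b) \<and> (\<forall>a b. \<sigma> (a * b) = \<sigma> a * \<sigma> b)"

definition semilinear_bij :: "('a::field ^ 4 \<Rightarrow> 'a ^ 4) \<Rightarrow> bool" where
  "semilinear_bij f \<longleftrightarrow>
     bij f \<and> (\<forall>x y. f (x + y) = f x + f y) \<and>
     (\<exists>\<sigma>. field_automorphism \<sigma> \<and> (\<forall>c x. f (c *s x) = \<sigma> c *s f x))"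

text \<open>Elements are maps on points (hence the restriction), so proportional semilinear maps
  give the same collineation.\<close>

definition PGammaU :: "nat \<Rightarrow> (('a::field ^ 4) set \<Rightarrow> ('a ^ 4) set) set" where
  "PGammaU q = {restrict (image f) pg_points | f.
     semilinear_bij f \<and> image f ` herm_surface q = herm_surface q}"

definition herm_equivalent :: "nat \<Rightarrow> ('a::field ^ 4) set set \<Rightarrow> ('a ^ 4) set set \<Rightarrow> bool" where
  "herm_equivalent q S T \<longleftrightarrow> (\<exists>g\<in>PGammaU q. g ` S = T)"

definition herm_veronesean :: "nat \<Rightarrow> ('a::field ^ 4) set set" where
  "herm_veronesean q =
     (\<lambda>x. vec.span {coords4 1 x (x ^ q) (x ^ (q + 1))}) ` UNIV \<union> {vec.span {coords4 0 0 0 1}}"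

end

theory Submission
  imports Defs
begin

text \<open>
Write \<open>F\<^sub>q\<close> for the subfield of elements fixed by \<open>cj x = x ^ q\<close>, and \<open>h\<close> for the Hermitian form. For vectors
\<open>a\<close>, \<open>b\<close>, \<open>c\<close> spanning three noncollinear points that are not on a line, the triangle is in perspective
only if the triple product \<open>h a b * h b c * h c a\<close> lies in \<open>F\<^sub>q\<close> (\<open>triple_product_fixed_if_in_perspective\<close>).

Fix a vector \<open>p\<close> spanning \<open>P\<close> and scale a vector \<open>r\<close> of every other point of \<open>S\<close> so that \<open>h r p = 1\<close>. Let \<open>u0\<close>, \<open>u1\<close>,
\<open>u2\<close> be the vectors of the three points \<open>Q i\<close>. The triple product of \<open>p\<close>, \<open>u\<close>, \<open>r\<close> becomes \<open>h u r\<close>, so the hypothesis says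
that \<open>h u r\<close> lies in \<open>F\<^sub>q\<close> for the three vectors \<open>u\<close> and all \<open>r\<close>; a further point of \<open>S\<close> on the line
joining \<open>P\<close> and \<open>Q i\<close>, which the criterion does not cover, is ruled out by means of another \<open>Q j\<close>
(\<open>h_u_fixed\<close>). As \<open>p\<close>, \<open>u0\<close>, \<open>u1\<close>, \<open>u2\<close> is a basis, \<open>r\<close> is
determined by the three values \<open>h r u\<close> in \<open>F\<^sub>q\<close>. Moreover \<open>h r r = 0\<close> determines one of them from the other
two: with the components \<open>w1\<close>, \<open>w2\<close> of \<open>u1\<close>, \<open>u2\<close> orthogonal to \<open>p\<close> and \<open>u0\<close>, the map \<open>r \<mapsto> (h r w1, h r w2)\<close> into
pairs of elements of \<open>F\<^sub>q\<close> is injective (\<open>inj_affine_coords\<close>). This gives the bound \<open>q\<^sup>2 + 1\<close>.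

If the bound is attained, that map is bijective, and noncollinearity makes \<open>h\<close> anisotropic on the
\<open>F\<^sub>q\<close>-span of \<open>w1\<close> and \<open>w2\<close> (\<open>anisotropic\<close>). An anisotropic binary quadratic form over \<open>F\<^sub>q\<close> is a multiple of the
norm \<open>x \<mapsto> x ^ (q + 1)\<close>, and the Hermitian Veronesean is the set obtained in the same way from the norm; so
a similitude of \<open>h\<close> maps \<open>S\<close> into the Veronesean, and onto it by counting (\<open>herm_equivalent_veronesean\<close>).
Conversely, collineations preserve the number of points, and the Veronesean has \<open>q\<^sup>2 + 1\<close> of them.
\<close>

section \<open>A finite field of odd square order and its conjugation\<close>

locale square_field =
  fixes q :: nat and field_type :: "'a :: {field, finite} itself"
  assumes primepow_q: "primepow q" and odd_q: "odd q" and card_field: "CARD('a) = q\<^sup>2"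
begin

lemma q_ge_3: "q \<ge> 3"
proof -
  have "q > 1" using primepow_gt_Suc_0[OF primepow_q] by simp
  then show ?thesis using odd_q by (cases "q = 2") auto
qed

text \<open>
Multiplication by a nonzero \<open>x\<close> permutes the nonzero elements; comparing their product before and
after gives \<open>x ^ (q\<^sup>2 - 1) = 1\<close>.
\<close>

lemma power_card_field: "(x :: 'a) ^ (q\<^sup>2) = x"
proof (cases "x = 0")
  case True
  then show ?thesis using q_ge_3 by simp
next
  case False
  let ?U = "UNIV - {0 :: 'a}"
  have bij: "bij_betw ((*) x) ?U ?U"
    by (rule bij_betwI[where g = "\<lambda>y. y / x"]) (use False in auto)
  have "\<Prod>?U = (\<Prod>y\<in>?U. x * y)"
    by (rule prod.reindex_bij_betw[OF bij, symmetric])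
  also have "\<dots> = x ^ card ?U * \<Prod>?U"
    by (simp add: prod.distrib)
  finally have "x ^ card ?U = 1" by simp
  moreover have "Suc (card ?U) = q\<^sup>2"
    using q_ge_3 by (simp add: card_Diff_singleton card_field)
  ultimately show ?thesis by (metis mult.right_neutral power_Suc)
qed

text \<open>
Translation by \<open>1\<close> permutes the field, so summing all elements before and after gives
\<open>q\<^sup>2 * 1 = 0\<close>.
\<close>

lemma CHAR_dvd_card: "CHAR('a) dvd q\<^sup>2"
proof -
  have "bij_betw (\<lambda>x :: 'a. x + 1) UNIV UNIV"
    by (rule bij_betwI[where g = "\<lambda>x. x - 1"]) auto
  then have "(\<Sum>x :: 'a\<in>UNIV. x + 1) = (\<Sum>x\<in>UNIV. x)"
    by (rule sum.reindex_bij_betw)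
  then have "of_nat (q\<^sup>2) = (0 :: 'a)"
    by (simp add: sum.distrib card_field)
  then show ?thesis by (simp only: of_nat_eq_0_iff_char_dvd)
qed

lemma q_eq_CHAR_power: "\<exists>k. q = CHAR('a) ^ k"
proof -
  obtain r k where r: "prime r" "q = r ^ k"
    using primepow_q by (auto simp: primepow_def)
  have pc: "prime CHAR('a)"
    using prime_CHAR_semidom[where ?'a = 'a] finite_imp_CHAR_pos[where ?'a = 'a] by simp
  have "CHAR('a) dvd r ^ (k * 2)"
    using CHAR_dvd_card r by (simp add: power_mult)
  then have "CHAR('a) dvd r" using pc prime_dvd_power by blast
  then have "CHAR('a) = r" using pc r primes_dvd_imp_eq by blast
  then show ?thesis using r by blast
qed

text \<open>
The involutory automorphism \<open>x \<mapsto> x ^ q\<close>. It is a constant of its own so that the simplifier moves it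
through sums and products instead of expanding powers.
\<close>

definition cj :: "'a \<Rightarrow> 'a" where "cj x = x ^ q"

lemma cj_add [simp]: "cj (x + y) = cj x + cj y"
proof -
  obtain k where k: "q = CHAR('a) ^ k" using q_eq_CHAR_power by blast
  have "prime CHAR('a)"
    using prime_CHAR_semidom[where ?'a = 'a] finite_imp_CHAR_pos[where ?'a = 'a] by simp
  then show ?thesis unfolding cj_def using freshmans_dream'[of q k x y] k by simp
qed

lemma cj_mult [simp]: "cj (x * y) = cj x * cj y"
  by (simp add: cj_def power_mult_distrib)

lemma cj_divide [simp]: "cj (x / y) = cj x / cj y"
  by (simp add: cj_def power_divide)

lemma cj_minus [simp]: "cj (- x) = - cj x"
  using odd_q by (simp add: cj_def power_minus_odd)

lemma cj_diff [simp]: "cj (x - y) = cj x - cj y"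
  using cj_add[of x "- y"] by simp

lemma cj_0 [simp]: "cj 0 = 0" and cj_1 [simp]: "cj 1 = 1"
  using q_ge_3 by (auto simp: cj_def)

lemma cj_cj [simp]: "cj (cj x) = x"
  using power_card_field[of x] by (simp add: cj_def power_mult[symmetric] power2_eq_square)

lemma cj_eq_0_iff [simp]: "cj x = 0 \<longleftrightarrow> x = 0"
  by (metis cj_0 cj_cj)

lemma cj_power [simp]: "cj (x ^ n) = cj x ^ n"
  by (simp add: cj_def power_mult[symmetric] mult.commute)

lemma two_neq_0: "(2 :: 'a) \<noteq> 0"
proof
  assume "(2 :: 'a) = 0"
  then have "of_nat 2 = (0 :: 'a)" by simp
  then have "CHAR('a) dvd 2" by (simp only: of_nat_eq_0_iff_char_dvd)
  moreover note CHAR_dvd_card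
  moreover have "coprime 2 (q\<^sup>2)" using odd_q by simp
  ultimately have "CHAR('a) = 1" using coprime_common_divisor_nat by blast
  then show False using of_nat_CHAR[where ?'a = 'a] by simp
qed

lemma cj_2 [simp]: "cj 2 = 2"
  by (metis cj_1 cj_add one_add_one)

text \<open>
The subfield \<open>F\<^sub>q\<close>. Most statements below speak of \<open>cj x = x\<close> directly, since simplification proves such
equations; the set is used only for counting.
\<close>

definition fixed_field :: "'a set" where "fixed_field = {x. cj x = x}"

lemma card_fixed_field_le: "card fixed_field \<le> q"
proof -
  let ?f = "monom 1 q - monom 1 1 :: 'a poly"
  have "coeff ?f q = 1" using q_ge_3 by simp
  then have nz: "?f \<noteq> 0" by (metis coeff_0 zero_neq_one)
  have "degree ?f \<le> q" using q_ge_3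
    by (intro degree_diff_le) (auto simp: degree_monom_eq)
  moreover have "fixed_field = {x. poly ?f x = 0}"
    by (auto simp: fixed_field_def cj_def poly_monom)
  ultimately show ?thesis using card_poly_roots_bound[OF nz] by simp
qed

text \<open>
Every element of \<open>F\<^sub>q\<close> is a square in the larger field: with \<open>n = (q\<^sup>2 - 1) div 2\<close>, squaring is two-to-one
on the nonzero elements, so the nonzero squares are at least \<open>n\<close> in number; as they are roots of
\<open>x ^ n = 1\<close>, they are all of its roots. A nonzero element of \<open>F\<^sub>q\<close> is such a root because
\<open>n\<close> is a multiple of \<open>q - 1\<close>.
\<close>

lemma square_root_of_fixed:
  assumes "cj d = d"
  shows "\<exists>y. y\<^sup>2 = d"
proof (cases "d = 0")
  case True
  then show ?thesis by auto
next
  case False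
  obtain m where m: "q = 2 * m + 1" using odd_q by (elim oddE)
  define n where "n = m * (q + 1)"
  have q2: "q\<^sup>2 = 2 * n + 1" unfolding n_def m by (simp add: power2_eq_square algebra_simps)
  have "n > 0" using q_ge_3 m by (simp add: n_def)
  let ?U = "UNIV - {0 :: 'a}" and ?R = "{x :: 'a. x ^ n = 1}"
  have cardU: "card ?U = 2 * n"
    using q2 by (simp add: card_Diff_singleton card_field)
  have cardR: "card ?R \<le> n" and finR: "finite ?R"
  proof -
    let ?f = "monom 1 n - 1 :: 'a poly"
    have "coeff ?f n = 1" using \<open>n > 0\<close> by simp
    then have "?f \<noteq> 0" by (metis coeff_0 zero_neq_one)
    moreover have "degree ?f \<le> n" by (intro degree_diff_le) (auto simp: degree_monom_eq)
    moreover have "?R = {x. poly ?f x = 0}" by (auto simp: poly_monom)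
    ultimately show "card ?R \<le> n" using card_poly_roots_bound[of ?f] by simp
  qed simp
  have sub: "power2 ` ?U \<subseteq> ?R"
  proof safe
    fix x :: 'a assume "x \<noteq> 0"
    have "x * x ^ (2 * n) = x" using power_card_field[of x] by (simp add: q2)
    then show "(x\<^sup>2) ^ n = 1" using \<open>x \<noteq> 0\<close> by (simp add: power_mult)
  qed
  \<comment> \<open>Each fibre of squaring has at most two elements.\<close>
  have "card ?U \<le> 2 * card (power2 ` ?U)"
  proof -
    have "?U \<subseteq> (\<Union>z\<in>power2 ` ?U. {x. x\<^sup>2 = z})" by auto
    then have "card ?U \<le> card (\<Union>z\<in>power2 ` ?U. {x. x\<^sup>2 = z})" by (intro card_mono) auto
    also have "\<dots> \<le> (\<Sum>z\<in>power2 ` ?U. card {x. x\<^sup>2 = z})" by (intro card_UN_le) auto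
    also have "\<dots> \<le> (\<Sum>z\<in>power2 ` ?U. 2)"
    proof (intro sum_mono)
      fix z :: 'a assume "z \<in> power2 ` ?U"
      then obtain x where "z = x\<^sup>2" by auto
      then have "{x. x\<^sup>2 = z} \<subseteq> {x, - x}" by (auto simp: power2_eq_iff)
      then have "card {x. x\<^sup>2 = z} \<le> card {x, - x}" by (intro card_mono) auto
      also have "\<dots> \<le> 2" by (simp add: card_insert_if)
      finally show "card {x. x\<^sup>2 = z} \<le> 2" .
    qed
    finally show ?thesis by simp
  qed
  then have "?R \<subseteq> power2 ` ?U"
    using card_seteq[OF finR sub] cardR cardU by simp
  moreover have "d ^ n = 1"
  proof -
    have "d * d ^ (2 * m) = d" using assms unfolding cj_def unfolding m by simp
    then have "d ^ (2 * m) = 1" using False by simp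
    moreover have "n = 2 * m * (m + 1)" by (simp add: n_def m)
    ultimately show ?thesis by (metis power_mult power_one)
  qed
  ultimately show ?thesis by auto
qed

end

section \<open>Points, lines and planes as spans\<close>

lemma forall_index4: "(\<forall>i :: 4. Pr i) \<longleftrightarrow> Pr 0 \<and> Pr 1 \<and> Pr 2 \<and> Pr 3"
proof -
  have "(4 :: 4) = 0" by simp
  show ?thesis unfolding forall_4 \<open>(4 :: 4) = 0\<close> by blast
qed

lemma coords4_nth [simp]:
  "coords4 a b c d $ 0 = a" "coords4 a b c d $ 1 = b" "coords4 a b c d $ 2 = c"
  "coords4 a b c d $ 3 = d"
  by (simp_all add: coords4_def)

lemma vec4_eq_iff: "(x :: 'a ^ 4) = y \<longleftrightarrow> x $ 0 = y $ 0 \<and> x $ 1 = y $ 1 \<and> x $ 2 = y $ 2 \<and> x $ 3 = y $ 3"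
  by (simp add: vec_eq_iff forall_index4)

lemma span_singleton_scale:
  assumes "k \<noteq> 0" shows "vec.span {k *s x} = vec.span {x :: 'a :: field ^ 'n}"
proof (rule vec.span_eq[THEN iffD2], intro conjI)
  show "{k *s x} \<subseteq> vec.span {x}" by (simp add: vec.span_scale vec.span_base)
  have "(1 / k) *s (k *s x) \<in> vec.span {k *s x}" by (intro vec.span_scale vec.span_base) simp
  then show "{x} \<subseteq> vec.span {k *s x}" using assms by simp
qed

lemma span_singleton_eq_imp: "vec.span {x} = vec.span {y} \<Longrightarrow> \<exists>k. x = k *s (y :: 'a :: field ^ 'n)"
  using vec.span_base[of x "{x}"] by (auto simp: vec.span_singleton)

lemma in_span_pair_iff: "x \<in> vec.span {a, b} \<longleftrightarrow> (\<exists>k l. x = k *s a + l *s (b :: 'a :: field ^ 'n))"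
  by (force simp: vec.span_insert[of a "{b}"] vec.span_singleton algebra_simps)

lemma pg_points_eq: "pg_points = {vec.span {x} | x. x \<noteq> (0 :: 'a :: field ^ 4)}"
proof safe
  fix X :: "('a ^ 4) set" assume X: "X \<in> pg_points"
  then have sub: "vec.subspace X" and dim: "vec.dim X = 1" by (auto simp: pg_points_def)
  obtain B where B: "B \<subseteq> X" "vec.independent B" "X \<subseteq> vec.span B" "card B = vec.dim X"
    using vec.basis_exists by blast
  then obtain x where x: "B = {x}" using dim by (metis card_1_singletonE)
  then have "X = vec.span {x}" using B sub vec.span_minimal by blast
  moreover have "x \<noteq> 0" using B x by auto
  ultimately show "\<exists>x. X = vec.span {x} \<and> x \<noteq> 0" by blast
next
  fix x :: "'a ^ 4" assume "x \<noteq> 0"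
  then show "vec.span {x} \<in> pg_points" by (simp add: pg_points_def)
qed

text \<open>
Extend a basis of the subspace to one of the whole space and drop one of the new vectors.
\<close>

lemma subset_pg_plane:
  fixes W :: "('a :: field ^ 4) set"
  assumes "vec.subspace W" and "W \<noteq> UNIV"
  shows "\<exists>E\<in>pg_planes. W \<subseteq> E"
proof -
  obtain B where B: "B \<subseteq> W" "vec.independent B" "W \<subseteq> vec.span B" "card B = vec.dim W"
    using vec.basis_exists by blast
  define C where "C = vec.extend_basis B"
  have C: "B \<subseteq> C" "vec.independent C" "vec.span C = UNIV"
    using vec.extend_basis_superset[OF B(2)] vec.independent_extend_basis[OF B(2)]
      vec.span_extend_basis[OF B(2)] by (auto simp: C_def)
  have "card C = 4"
    using vec.dim_span_eq_card_independent[OF C(2)] C(3) vec_dim_card[where ?'n = 4 and ?'a = 'a]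
    by simp
  have "B \<noteq> C" using B C assms vec.span_minimal by blast
  then obtain e where e: "e \<in> C" "e \<notin> B" using C by blast
  have ind: "vec.independent (C - {e})" using C(2) vec.independent_mono by blast
  have "card (C - {e}) = 3" using e \<open>card C = 4\<close> by simp
  then have "vec.span (C - {e}) \<in> pg_planes"
    by (auto simp: pg_planes_def vec.dim_eq_card_independent[OF ind])
  moreover have "W \<subseteq> vec.span (C - {e})"
    using B(3) vec.span_mono[of B "C - {e}"] C(1) e by blast
  ultimately show ?thesis by blast
qed

lemma span_UNIV_if_not_coplanar:
  assumes "\<not> pg_coplanar {vec.span {a}, vec.span {b}, vec.span {c}, vec.span {d :: 'a :: field ^ 4}}"
  shows "vec.span {a, b, c, d} = UNIV"
proof (rule ccontr)
  assume "vec.span {a, b, c, d} \<noteq> UNIV"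
  then obtain E where E: "E \<in> pg_planes" "vec.span {a, b, c, d} \<subseteq> E"
    using subset_pg_plane[OF vec.subspace_span] by blast
  have "vec.span {x} \<subseteq> E" if "x \<in> {a, b, c, d}" for x
  proof -
    have "vec.span {x} \<subseteq> vec.span {a, b, c, d}" using that by (intro vec.span_mono) simp
    then show ?thesis using E(2) by (rule order_trans)
  qed
  then show False using assms E(1) unfolding pg_coplanar_def by blast
qed

lemma card_ge_4_if_span_UNIV:
  fixes B :: "('a :: field ^ 4) set"
  assumes "vec.span B = UNIV" and "finite B" shows "card B \<ge> 4"
  using vec.dim_le_card[of UNIV B] assms vec_dim_card[where ?'n = 4 and ?'a = 'a] by simp

section \<open>The Hermitian form\<close>

context square_field
begin

abbreviation h :: "'a ^ 4 \<Rightarrow> 'a ^ 4 \<Rightarrow> 'a" where "h \<equiv> herm_form q"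

lemma h_eq: "h x y = x $ 0 * cj (y $ 3) + x $ 3 * cj (y $ 0) - x $ 1 * cj (y $ 1) - x $ 2 * cj (y $ 2)"
  by (simp add: herm_form_def cj_def)

lemma h_linear [simp]:
  "h (x + y) z = h x z + h y z" "h (x - y) z = h x z - h y z" "h (k *s x) z = k * h x z"
  "h 0 z = 0"
  "h z (x + y) = h z x + h z y" "h z (x - y) = h z x - h z y" "h z (k *s x) = cj k * h z x"
  "h z 0 = 0"
  by (simp_all add: h_eq algebra_simps)

lemma h_coords4:
  "h (coords4 a b c d) (coords4 a' b' c' d') = a * cj d' + d * cj a' - b * cj b' - c * cj c'"
  by (simp add: h_eq)

lemma h_swap: "h y x = cj (h x y)"
  by (simp add: h_eq)

lemma h_eq_0_commute: "h y x = 0 \<longleftrightarrow> h x y = 0"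
  by (metis h_swap cj_eq_0_iff)

lemma h_nondegenerate:
  assumes "\<And>y. h x y = 0" shows "x = 0"
  using assms[of "coords4 1 0 0 0"] assms[of "coords4 0 1 0 0"] assms[of "coords4 0 0 1 0"]
    assms[of "coords4 0 0 0 1"]
  by (simp add: h_eq vec4_eq_iff)

lemma h_span_right_eq_0:
  assumes "\<And>b. b \<in> B \<Longrightarrow> h x b = 0" and "y \<in> vec.span B"
  shows "h x y = 0"
proof -
  have "vec.subspace {y. h x y = 0}"
    by (rule vec.subspaceI) auto
  then have "vec.span B \<subseteq> {y. h x y = 0}" using assms(1) by (intro vec.span_minimal) auto
  then show ?thesis using assms(2) by auto
qed

lemma eq_0_if_orthogonal_to_spanning:
  assumes "vec.span B = UNIV" and "\<And>b. b \<in> B \<Longrightarrow> h x b = 0"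
  shows "x = 0"
  using h_nondegenerate h_span_right_eq_0 assms by blast

lemma herm_collinear_span:
  "herm_collinear q (vec.span {x}) (vec.span {y}) \<longleftrightarrow> h x y = 0"
  using vec.span_base[of x "{x}"] vec.span_base[of y "{y}"]
  by (auto simp: herm_collinear_def vec.span_singleton)

lemma ex_normalised_representative:
  assumes "X \<in> herm_surface q" and "\<not> herm_collinear q X (vec.span {p})"
  shows "\<exists>x. X = vec.span {x} \<and> h x p = 1"
proof -
  obtain y where y: "X = vec.span {y}" "y \<noteq> 0"
    using assms(1) by (auto simp: herm_surface_def pg_points_eq)
  then have nz: "h y p \<noteq> 0" using assms(2) herm_collinear_span by blast
  let ?x = "(1 / h y p) *s y"
  have "vec.span {?x} = vec.span {y}"
    using nz by (intro span_singleton_scale) simp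
  then have "X = vec.span {?x}" using y(1) by (simp only:)
  moreover have "h ?x p = 1" using nz by simp
  ultimately show ?thesis by (intro exI conjI)
qed

section \<open>Triangles in perspective\<close>

lemma perp_span_singleton: "perp q (vec.span {a}) = {y. h a y = 0}"
  using vec.span_base[of a "{a}"] by (auto simp: perp_def vec.span_singleton)

text \<open>
Let \<open>a\<close>, \<open>b\<close>, \<open>c\<close> span the vertices. The plane through \<open>c\<close> and the polar line of \<open>a b\<close> is the polar
plane of the point of the line \<open>a b\<close> that is orthogonal to \<open>c\<close>, namely \<open>h b c *s a - h a c *s b\<close>. The three planes
thus meet in a line only if the three points so obtained are linearly dependent. For independent
\<open>a\<close>, \<open>b\<close>, \<open>c\<close> the determinant of their coordinates is \<open>T - cj T\<close> with the triple product \<open>T = h a b * h b c * h c a\<close>, so that \<open>T\<close>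
lies in \<open>F\<^sub>q\<close>.

Dependent vertices have to be excluded: three points of a hyperbolic line are always in perspective,
but there \<open>cj T = - T\<close>.
\<close>

lemma triple_product_fixed_if_in_perspective:
  assumes persp: "in_perspective q (vec.span {a}) (vec.span {b}) (vec.span {c})"
    and a: "h a a = 0" and ab: "h a b \<noteq> 0" and ac: "h a c \<noteq> 0" and c: "c \<notin> vec.span {a, b}"
  shows "cj (h a b * h b c * h c a) = h a b * h b c * h c a"
proof (rule ccontr)
  let ?T = "h a b * h b c * h c a"
  assume T: "cj ?T \<noteq> ?T"
  define L where "L = vec.span ((perp q (vec.span {a}) \<inter> perp q (vec.span {b})) \<union> vec.span {c})
     \<inter> vec.span ((perp q (vec.span {b}) \<inter> perp q (vec.span {c})) \<union> vec.span {a})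
     \<inter> vec.span ((perp q (vec.span {c}) \<inter> perp q (vec.span {a})) \<union> vec.span {b})"
  have dimL: "vec.dim L = 2" using persp by (simp add: in_perspective_def L_def pg_lines_def)
  \<comment> \<open>The plane through \<open>c\<close> lies in the polar plane of \<open>h b c *s a - h a c *s b\<close>; used for the three cyclic
    rotations of the vertices.\<close>
  have plane: "h b c * h a y = h a c * h b y"
    if "y \<in> vec.span ((perp q (vec.span {a}) \<inter> perp q (vec.span {b})) \<union> vec.span {c})" for a b c y
  proof -
    have "h (h b c *s a - h a c *s b) y = 0"
      by (rule h_span_right_eq_0[OF _ that[unfolded perp_span_singleton]])
        (auto simp: vec.span_singleton)
    then show ?thesis by simp
  qed
  have orth: "h a y = 0 \<and> h b y = 0 \<and> h c y = 0" if "y \<in> L" for y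
  proof -
    have 1: "h b c * h a y = h a c * h b y" and 2: "h c a * h b y = h b a * h c y"
      and 3: "h a b * h c y = h c b * h a y"
      using that by (auto simp: L_def intro!: plane)
    have "?T * h a y = h a b * h c a * (h b c * h a y)" by simp
    also have "\<dots> = h a b * h a c * (h c a * h b y)" by (simp add: 1)
    also have "\<dots> = h a c * h b a * (h a b * h c y)" by (simp add: 2)
    also have "\<dots> = h b a * h c b * h a c * h a y" by (simp add: 3)
    also have "h b a * h c b * h a c = cj ?T"
      by (simp add: h_swap[of b a] h_swap[of c b] h_swap[of a c])
    finally have "h a y = 0" using T by auto
    then show ?thesis using 1 3 ab ac by auto
  qed
  \<comment> \<open>So \<open>L\<close> is orthogonal to the plane spanned by \<open>a\<close>, \<open>b\<close>, \<open>c\<close>. A vector \<open>l\<close> outside this plane turns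
    \<open>y \<mapsto> h y l\<close> into an injective linear functional on \<open>L\<close>, which bounds its dimension by \<open>1\<close>.\<close>
  have "a \<noteq> 0" using ab by auto
  moreover have b: "b \<notin> vec.span {a}" using a ab by (auto simp: vec.span_singleton)
  moreover have c': "c \<notin> vec.span {b, a}" using c by (simp add: insert_commute)
  moreover have "b \<notin> {a}" "c \<notin> {b, a}"
    by (rule contra_subsetD[OF vec.span_superset], fact)+
  ultimately have ind: "vec.independent {c, b, a}" and card3: "card {c, b, a} = 3"
    by (simp_all add: vec.independent_insert)
  then have "vec.span {c, b, a} \<noteq> UNIV" using card_ge_4_if_span_UNIV[of "{c, b, a}"] by auto
  then obtain l where l: "l \<notin> vec.span {c, b, a}" by blast
  then have "l \<notin> {c, b, a}" by (rule contra_subsetD[OF vec.span_superset])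
  then have "card {l, c, b, a} = 4" using card3 by simp
  moreover have "vec.independent {l, c, b, a}" using ind l \<open>l \<notin> {c, b, a}\<close>
    by (simp add: vec.independent_insert)
  ultimately have span: "vec.span {l, c, b, a} = UNIV"
    using vec.card_ge_dim_independent[of "{l, c, b, a}" UNIV] vec_dim_card[where ?'n = 4 and ?'a = 'a]
    by auto
  have zero: "y = 0" if "y \<in> L" "h y l = 0" for y
    using orth[OF that(1)] that(2) h_eq_0_commute
    by (intro eq_0_if_orthogonal_to_spanning[OF span]) auto
  have subL: "vec.subspace L"
    unfolding L_def by (intro vec.subspace_inter vec.subspace_span)
  have "\<exists>z. L \<subseteq> vec.span {z}"
  proof (cases "\<exists>z\<in>L. h z l \<noteq> 0")
    case True
    then obtain z where z: "z \<in> L" "h z l \<noteq> 0" by blast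
    have "y \<in> vec.span {z}" if "y \<in> L" for y
    proof -
      have "y - (h y l / h z l) *s z = 0"
        using z that subL by (intro zero vec.subspace_diff vec.subspace_scale) auto
      then show ?thesis by (auto simp: vec.span_singleton)
    qed
    then show ?thesis by blast
  next
    case False
    then have "L \<subseteq> vec.span {0}" using zero by auto
    then show ?thesis by blast
  qed
  then obtain z where "L \<subseteq> vec.span {z}" ..
  then have "vec.dim L \<le> card {z}" by (rule vec.dim_le_card) simp
  then show False using dimL by simp
qed

section \<open>Unitary collineations and the Hermitian Veronesean\<close>

lemma herm_surface_eq: "herm_surface q = {vec.span {x} | x :: 'a ^ 4. x \<noteq> 0 \<and> h x x = 0}"
proof -
  have "(\<forall>y\<in>vec.span {x}. h y y = 0) \<longleftrightarrow> h x x = 0" for x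
    using vec.span_base[of x "{x}"] by (auto simp: vec.span_singleton)
  then show ?thesis unfolding herm_surface_def pg_points_eq by blast
qed

text \<open>
A linear map that multiplies the form by a nonzero constant is injective because the form is
nondegenerate, hence bijective as the space is finite, and it preserves isotropy.
\<close>

lemma similitude_in_PGammaU:
  fixes f :: "'a ^ 4 \<Rightarrow> 'a ^ 4"
  assumes add: "\<And>x y. f (x + y) = f x + f y" and scale: "\<And>k x. f (k *s x) = k *s f x"
    and sim: "\<And>x y. h (f x) (f y) = c * h x y" and c: "c \<noteq> 0"
  shows "restrict (image f) pg_points \<in> PGammaU q"
proof -
  have zero: "x = 0" if "f x = 0" for x
  proof (rule h_nondegenerate)
    show "h x y = 0" for y using sim[of x y] that c by simp
  qed
  have "inj f"
  proof (rule injI)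
    fix x y assume "f x = f y"
    moreover have "f (x - y) = f x - f y" using add[of "x - y" y] by simp
    ultimately show "x = y" using zero[of "x - y"] by simp
  qed
  then have "bij f" using finite_UNIV_inj_surj[of f] by (simp add: bij_def)
  have "semilinear_bij f"
    unfolding semilinear_bij_def field_automorphism_def
    using \<open>bij f\<close> add scale by (auto intro!: exI[of _ id])
  moreover have "image f ` herm_surface q = herm_surface q"
  proof (rule endo_inj_surj)
    show "finite (herm_surface q :: ('a ^ 4) set set)" by simp
    show "inj_on (image f) (herm_surface q)"
      using \<open>inj f\<close> by (auto intro: inj_onI simp: inj_image_eq_iff)
    show "image f ` herm_surface q \<subseteq> herm_surface q"
    proof safe
      fix X :: "('a ^ 4) set" assume "X \<in> herm_surface q"
      then obtain x where x: "X = vec.span {x}" "x \<noteq> 0" "h x x = 0" by (auto simp: herm_surface_eq)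
      have "f ` X = vec.span {f x}" by (simp add: x(1) vec.span_singleton image_image scale)
      then show "f ` X \<in> herm_surface q" using x zero sim[of x x] by (auto simp: herm_surface_eq)
    qed
  qed
  ultimately show ?thesis by (auto simp: PGammaU_def)
qed

text \<open>
The first coordinate normalises the spanning vectors, and then the second one is the parameter.
\<close>

lemma card_herm_veronesean: "card (herm_veronesean q :: ('a ^ 4) set set) = q\<^sup>2 + 1"
proof -
  let ?v = "\<lambda>x :: 'a. coords4 1 x (x ^ q) (x ^ (q + 1))"
  have "inj (\<lambda>x. vec.span {?v x})"
  proof (rule injI)
    fix x y assume "vec.span {?v x} = vec.span {?v y}"
    then obtain k where "?v x = k *s ?v y" using span_singleton_eq_imp by blast
    then show "x = y" by (simp add: vec4_eq_iff)
  qed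
  then have "card (range (\<lambda>x. vec.span {?v x})) = q\<^sup>2" by (simp add: card_image card_field)
  moreover have "vec.span {coords4 0 0 0 1} \<noteq> vec.span {?v x}" for x
  proof
    assume "vec.span {coords4 0 0 0 1} = vec.span {?v x}"
    then obtain k where "coords4 0 0 0 1 = k *s ?v x" using span_singleton_eq_imp by blast
    then show False by (auto simp: vec4_eq_iff)
  qed
  then have "vec.span {coords4 0 0 0 1} \<notin> range (\<lambda>x. vec.span {?v x})" by blast
  ultimately show ?thesis unfolding herm_veronesean_def by simp
qed

end

lemma card_eq_if_herm_equivalent:
  assumes "herm_equivalent q S T" and "S \<subseteq> pg_points"
  shows "card S = card T"
proof -
  obtain f where f: "semilinear_bij f" "restrict (image f) pg_points ` S = T"
    using assms(1) by (auto simp: herm_equivalent_def PGammaU_def)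
  have "restrict (image f) pg_points ` S = image f ` S"
    using assms(2) by (intro image_cong) auto
  moreover have "inj (image f)"
    using f(1) by (auto simp: semilinear_bij_def bij_def inj_image_eq_iff intro: injI)
  then have "card (image f ` S) = card S" by (meson card_image inj_on_subset subset_UNIV)
  ultimately show ?thesis using f(2) by simp
qed

section \<open>Sets with many triangles in perspective\<close>

text \<open>
The hypotheses of the theorem in terms of vectors. The vector \<open>p\<close> spans \<open>P\<close>, and the other three points
are spanned by \<open>u0\<close>, \<open>u1\<close>, \<open>u2\<close>, scaled so that their product with \<open>p\<close> is \<open>1\<close>. The point of \<open>u0\<close> is
singled out: together with \<open>p\<close> it forms the hyperbolic pair with respect to which coordinates are
taken.
\<close>

locale perspective_set = square_field q field_type for q and field_type :: "'a :: {field, finite} itself" +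
  fixes S :: "('a ^ 4) set set" and p u0 u1 u2 :: "'a ^ 4"
  assumes S_sub: "S \<subseteq> herm_surface q"
    and noncollinear: "\<And>X Y. X \<in> S \<Longrightarrow> Y \<in> S \<Longrightarrow> X \<noteq> Y \<Longrightarrow> \<not> herm_collinear q X Y"
    and p_in: "vec.span {p} \<in> S"
    and u_in: "\<And>x. x \<in> {u0, u1, u2} \<Longrightarrow> vec.span {x} \<in> S"
    and h_u_p: "\<And>x. x \<in> {u0, u1, u2} \<Longrightarrow> h x p = 1"
    and span_UNIV: "vec.span {p, u0, u1, u2} = UNIV"
    and persp: "\<And>x R. x \<in> {u0, u1, u2} \<Longrightarrow> R \<in> S - {vec.span {p}, vec.span {x}}
      \<Longrightarrow> in_perspective q (vec.span {p}) (vec.span {x}) R"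
begin

lemma isotropic: "vec.span {x} \<in> S \<Longrightarrow> h x x = 0"
  using S_sub vec.span_base[of x "{x}"] by (auto simp: herm_surface_def)

lemma h_p_p [simp]: "h p p = 0"
  using isotropic p_in by blast

text \<open>
A point of \<open>S\<close> other than that of \<open>p\<close> is not orthogonal to \<open>p\<close>, so exactly one of its vectors lies here.
\<close>

definition affine_set :: "('a ^ 4) set" where
  "affine_set = {r. vec.span {r} \<in> S \<and> h r p = 1}"

lemma affine_setD:
  assumes "r \<in> affine_set"
  shows "vec.span {r} \<in> S" and "h r p = 1" and "h p r = 1" and "h r r = 0"
  using assms isotropic h_swap[of p r] by (auto simp: affine_set_def)

lemma span_neq_span_p:
  assumes "r \<in> affine_set" shows "vec.span {r} \<noteq> vec.span {p}"
proof
  assume "vec.span {r} = vec.span {p}"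
  then obtain k where "r = k *s p" using span_singleton_eq_imp by blast
  then have "h r p = 0" by simp
  then show False using affine_setD(2)[OF assms] by simp
qed

lemma u_in_affine_set: "x \<in> {u0, u1, u2} \<Longrightarrow> x \<in> affine_set"
  unfolding affine_set_def using u_in h_u_p by blast

lemmas u_simps = affine_setD[OF u_in_affine_set]

lemma distinct_u: "u0 \<noteq> u1" "u0 \<noteq> u2" "u1 \<noteq> u2"
proof -
  have "card {p, u0, u1, u2} \<ge> 4" using card_ge_4_if_span_UNIV[OF span_UNIV] by simp
  then show "u0 \<noteq> u1" "u0 \<noteq> u2" "u1 \<noteq> u2"
    by (auto simp: card_insert_if split: if_splits)
qed

lemma span_three_neq_UNIV: "vec.span {x, y, z :: 'a ^ 4} \<noteq> UNIV"
proof
  assume "vec.span {x, y, z} = UNIV"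
  then have "card {x, y, z} \<ge> 4" by (rule card_ge_4_if_span_UNIV) simp
  then show False by (auto simp: card_insert_if split: if_splits)
qed

lemma span_UNIV_eq:
  assumes "{p, u0, u1, u2} \<subseteq> vec.span B" shows "vec.span B = UNIV"
  using vec.span_minimal[OF assms vec.subspace_span] span_UNIV by blast

lemma u_notin_span:
  assumes "x \<in> {u0, u1, u2}" "y \<in> {u0, u1, u2}" "x \<noteq> y"
  shows "x \<notin> vec.span {p, y}"
proof
  assume x: "x \<in> vec.span {p, y}"
  obtain z where z: "{u0, u1, u2} = {x, y, z}" using assms by auto
  have "x \<in> vec.span {p, y, z}" using x vec.span_mono[of "{p, y}" "{p, y, z}"] by blast
  then have "{p, u0, u1, u2} \<subseteq> vec.span {p, y, z}"
    using z vec.span_superset[of "{p, y, z}"] by simp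
  then have "vec.span {p, y, z} = UNIV" by (rule span_UNIV_eq)
  with span_three_neq_UNIV show False ..
qed

text \<open>
For the normalised vectors the triple product of \<open>p\<close>, \<open>x\<close>, \<open>r\<close> is just \<open>h x r\<close>. What remains is a point
\<open>r = x + k *s p\<close> of the line joining \<open>p\<close> and \<open>x\<close>, where perspectivity gives no information. Any other of
the three given points, \<open>y\<close> say, is off this line, so \<open>h y x\<close> and \<open>h y r\<close> lie in \<open>F\<^sub>q\<close>, and with them their
difference \<open>cj k\<close>. Isotropy of \<open>r\<close> says \<open>k + cj k = 0\<close>, whence \<open>k = 0\<close> in odd characteristic, and \<open>r = x\<close>.
\<close>

lemma h_u_fixed:
  assumes r: "r \<in> affine_set" and x: "x \<in> {u0, u1, u2}"
  shows "cj (h x r) = h x r"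
proof -
  have generic: "cj (h x r) = h x r"
    if r: "r \<in> affine_set" and x: "x \<in> {u0, u1, u2}" and "r \<notin> vec.span {p, x}" for r x
  proof -
    note [simp] = u_simps[OF x] affine_setD[OF r]
    have "vec.span {r} \<noteq> vec.span {p}" using span_neq_span_p[OF r] .
    moreover have "vec.span {r} \<noteq> vec.span {x}"
      using that(3) vec.span_base[of r "{r}"] vec.span_mono[of "{x}" "{p, x}"] by blast
    ultimately have "in_perspective q (vec.span {p}) (vec.span {x}) (vec.span {r})"
      by (intro persp x) simp
    from triple_product_fixed_if_in_perspective[OF this] that(3) show ?thesis by simp
  qed
  show ?thesis
  proof (cases "r \<in> vec.span {p, x}")
    case False
    then show ?thesis using generic r x by blast
  next
    case True
    note [simp] = u_simps[OF x] affine_setD[OF r]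
    from True obtain k l where kl: "r = k *s p + l *s x" by (auto simp: in_span_pair_iff)
    then have "h r p = l" by simp
    then have "l = 1" using affine_setD(2)[OF r] by simp
    then have rk: "r = k *s p + x" using kl by simp
    obtain y where y: "y \<in> {u0, u1, u2}" "y \<noteq> x" using distinct_u by blast
    note [simp] = u_simps[OF y(1)]
    have xy: "x \<notin> vec.span {p, y}" using u_notin_span x y by blast
    moreover have "r \<notin> vec.span {p, y}"
    proof
      assume "r \<in> vec.span {p, y}"
      then have "r - k *s p \<in> vec.span {p, y}"
        by (intro vec.span_diff vec.span_scale) (auto intro: vec.span_base)
      then show False using xy rk by simp
    qed
    ultimately have "cj (h y x) = h y x" "cj (h y r) = h y r"
      using generic u_in_affine_set[OF x] r y(1) by blast+
    then have k: "cj k = k" by (simp add: rk)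
    have "h r r = k + cj k" by (simp add: rk)
    then have "k = 0" using k two_neq_0 by (simp add: mult_2[symmetric])
    then show ?thesis by (simp add: rk)
  qed
qed

text \<open>
The component of \<open>x\<close> orthogonal to the hyperbolic pair \<open>p\<close>, \<open>u0\<close>, for \<open>x\<close> with \<open>h x p = 1\<close>.
\<close>

definition w :: "'a ^ 4 \<Rightarrow> 'a ^ 4" where "w x = x - u0 - h x u0 *s p"

abbreviation "w1 \<equiv> w u1"
abbreviation "w2 \<equiv> w u2"

lemma h_u0 [simp]: "h u0 p = 1" "h p u0 = 1" "h u0 u0 = 0"
  using u_simps[of u0] by auto

lemma h_w [simp]:
  assumes "x \<in> {u0, u1, u2}"
  shows "h (w x) p = 0" "h (w x) u0 = 0" "h p (w x) = 0" "h u0 (w x) = 0"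
proof -
  show *: "h (w x) p = 0" "h (w x) u0 = 0" using assms by (simp_all add: w_def h_u_p)
  then show "h p (w x) = 0" "h u0 (w x) = 0" using h_eq_0_commute by blast+
qed

lemma h_affine_fixed:
  assumes "r \<in> affine_set"
  shows "cj (h r u0) = h r u0" "cj (h r w1) = h r w1" "cj (h r w2) = h r w2"
proof -
  have *: "cj (h r x) = h r x" if "x \<in> {u0, u1, u2}" for x
    using h_u_fixed[OF assms that] h_swap by metis
  then show "cj (h r u0) = h r u0" by simp
  have "cj (h r (w x)) = h r (w x)" if x: "x \<in> {u0, u1, u2}" for x
    using *[OF x] *[of u0] h_u_fixed[OF u_in_affine_set x, of u0] affine_setD[OF assms]
    by (simp add: w_def)
  then show "cj (h r w1) = h r w1" "cj (h r w2) = h r w2" by simp_all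
qed

lemma h_w_fixed:
  assumes "x \<in> {u1, u2}" and "y \<in> {u1, u2}"
  shows "cj (h (w x) (w y)) = h (w x) (w y)"
proof -
  have x: "x \<in> {u0, u1, u2}" and y: "y \<in> {u0, u1, u2}" using assms by auto
  have "h (w x) (w y) = h x (w y)" using y by (simp add: w_def[of x])
  then show ?thesis using h_affine_fixed[OF u_in_affine_set[OF x]] assms by auto
qed

lemma eq_0_if_orthogonal:
  assumes "h x p = 0" "h x u0 = 0" "h x w1 = 0" "h x w2 = 0"
  shows "x = 0"
  by (rule eq_0_if_orthogonal_to_spanning[OF span_UNIV]) (use assms in \<open>auto simp: w_def\<close>)

lemma orthogonal_p_w_imp:
  assumes "h d p = 0" "h d w1 = 0" "h d w2 = 0"
  shows "d = h d u0 *s p"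
proof -
  have "d - h d u0 *s p = 0" using assms by (intro eq_0_if_orthogonal) simp_all
  then show ?thesis by simp
qed

lemma w1_neq_0: "w1 \<noteq> 0"
proof
  assume "w1 = 0"
  then have "u1 = h u1 u0 *s p + 1 *s u0" by (simp add: w_def algebra_simps)
  then have "u1 \<in> vec.span {p, u0}" unfolding in_span_pair_iff by blast
  then show False using u_notin_span[of u1 u0] distinct_u by simp
qed

lemma w_independent: "w2 \<noteq> k *s w1"
proof
  assume *: "w2 = k *s w1"
  have "u2 = w2 + u0 + h u2 u0 *s p" by (simp add: w_def)
  also have "\<dots> = k *s (u1 - u0 - h u1 u0 *s p) + u0 + h u2 u0 *s p" by (simp only: *) (simp add: w_def)
  also have "\<dots> \<in> vec.span {p, u0, u1}"
    by (intro vec.span_add vec.span_diff vec.span_scale) (auto intro: vec.span_base)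
  finally have "{p, u0, u1, u2} \<subseteq> vec.span {p, u0, u1}"
    using vec.span_superset[of "{p, u0, u1}"] by simp
  then have "vec.span {p, u0, u1} = UNIV" by (rule span_UNIV_eq)
  with span_three_neq_UNIV show False ..
qed

definition affine_coords :: "'a ^ 4 \<Rightarrow> 'a \<times> 'a" where
  "affine_coords r = (h r w1, h r w2)"

text \<open>
Among the points of an affine line in direction \<open>p\<close>, isotropy fixes the coordinate along \<open>p\<close> up to an
element of trace zero, and \<open>F\<^sub>q\<close> contains no such element but \<open>0\<close> because \<open>q\<close> is odd.
\<close>

lemma isotropic_shift:
  assumes "h r r = 0" "h r' r' = 0" "h r' p = 1" "r = r' + k *s p" "cj k = k"
  shows "k = 0"
proof -
  have "h p r' = 1" using assms(3) h_swap[of p r'] by simp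
  then have "h r r = k + k" using assms by simp
  then show ?thesis using assms(1) two_neq_0 by (simp add: mult_2[symmetric])
qed

text \<open>
Two vectors with the same coordinates differ by a multiple of \<open>p\<close>, whose coefficient lies in \<open>F\<^sub>q\<close>; so
isotropy makes them equal.
\<close>

lemma inj_affine_coords: "inj_on affine_coords affine_set"
proof (rule inj_onI)
  fix r r' assume r: "r \<in> affine_set" and r': "r' \<in> affine_set"
    and "affine_coords r = affine_coords r'"
  moreover define k where "k = h (r - r') u0"
  ultimately have "r - r' = k *s p"
    unfolding k_def
    by (intro orthogonal_p_w_imp) (simp_all add: affine_coords_def affine_setD(2)[OF r] affine_setD(2)[OF r'])
  then have rk: "r = r' + k *s p" by (simp add: diff_eq_eq add.commute)
  moreover have "k = 0"
    using h_affine_fixed(1)[OF r] h_affine_fixed(1)[OF r']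
    by (intro isotropic_shift[OF affine_setD(4)[OF r] affine_setD(4,2)[OF r'] rk]) (simp add: k_def)
  ultimately show "r = r'" by simp
qed

lemma affine_coords_in: "affine_coords ` affine_set \<subseteq> fixed_field \<times> fixed_field"
  by (auto simp: affine_coords_def fixed_field_def h_affine_fixed)

lemma bij_affine_set: "bij_betw (\<lambda>r. vec.span {r}) affine_set (S - {vec.span {p}})"
proof (rule bij_betwI')
  fix r r' assume r: "r \<in> affine_set" "r' \<in> affine_set"
  show "(vec.span {r} = vec.span {r'}) = (r = r')"
  proof
    assume "vec.span {r} = vec.span {r'}"
    then obtain k where "r = k *s r'" using span_singleton_eq_imp by blast
    then show "r = r'" using affine_setD(2)[OF r(1)] affine_setD(2)[OF r(2)] by simp
  qed simp
next
  fix r assume r: "r \<in> affine_set"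
  then show "vec.span {r} \<in> S - {vec.span {p}}"
    using affine_setD(1) span_neq_span_p by simp
next
  fix X assume X: "X \<in> S - {vec.span {p}}"
  then have "X \<in> herm_surface q" "\<not> herm_collinear q X (vec.span {p})"
    using S_sub noncollinear p_in by auto
  from ex_normalised_representative[OF this] X
  show "\<exists>r\<in>affine_set. X = vec.span {r}" by (auto simp: affine_set_def)
qed

lemma card_S: "card S = card affine_set + 1"
proof -
  have "card affine_set = card (S - {vec.span {p}})" by (rule bij_betw_same_card[OF bij_affine_set])
  then show ?thesis using card.remove[OF _ p_in] by simp
qed

lemma card_affine_coords_image: "card (affine_coords ` affine_set) = card affine_set"
  by (rule card_image[OF inj_affine_coords])

lemma card_fixed_pairs_le: "card (fixed_field \<times> fixed_field) \<le> q\<^sup>2"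
  using mult_le_mono[OF card_fixed_field_le card_fixed_field_le]
  by (simp add: card_cartesian_product power2_eq_square)

lemma card_S_le: "card S \<le> q\<^sup>2 + 1"
  using card_mono[OF _ affine_coords_in] card_affine_coords_image card_fixed_pairs_le card_S by simp

end

section \<open>The case of equality\<close>

locale full_perspective_set = perspective_set +
  assumes card_S_eq: "card S = q\<^sup>2 + 1"
begin

text \<open>
Counting now turns the injection into \<open>F\<^sub>q\<close>-pairs into a bijection, so points with prescribed coordinates exist.
\<close>

lemma affine_coords_onto:
  assumes "cj s = s" and "cj t = t"
  shows "\<exists>r\<in>affine_set. h r w1 = s \<and> h r w2 = t"
proof -
  have "affine_coords ` affine_set = fixed_field \<times> fixed_field"
    using card_S card_S_eq card_affine_coords_image card_fixed_pairs_le
    by (intro card_seteq affine_coords_in) auto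
  moreover have "(s, t) \<in> fixed_field \<times> fixed_field" using assms by (simp add: fixed_field_def)
  ultimately have "(s, t) \<in> affine_coords ` affine_set" by simp
  then show ?thesis by (auto simp: affine_coords_def)
qed

text \<open>
The vectors \<open>v\<close> considered here include all combinations of \<open>w1\<close> and \<open>w2\<close> over \<open>F\<^sub>q\<close>. If such a \<open>v\<close> is isotropic, the member
of \<open>S\<close> with the coordinates of \<open>v\<close> is spanned by \<open>u0 + v\<close>, which is orthogonal to \<open>u0\<close>, although distinct points of \<open>S\<close> are not
collinear.
\<close>

lemma anisotropic:
  assumes orth: "h v p = 0" "h v u0 = 0" and fixed: "cj (h v w1) = h v w1" "cj (h v w2) = h v w2"
    and iso: "h v v = 0"
  shows "v = 0"
proof -
  obtain r where r: "r \<in> affine_set" "h r w1 = h v w1" "h r w2 = h v w2"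
    using affine_coords_onto[OF fixed] by blast
  have [simp]: "h u0 v = 0" using orth h_eq_0_commute by blast
  define k where "k = h (r - (u0 + v)) u0"
  have "r - (u0 + v) = k *s p"
    unfolding k_def by (intro orthogonal_p_w_imp) (simp_all add: r orth affine_setD(2)[OF r(1)])
  then have rk: "r = (u0 + v) + k *s p" by (simp add: diff_eq_eq add.commute)
  have "cj k = k" using h_affine_fixed(1)[OF r(1)] by (simp add: k_def orth)
  then have "k = 0"
    by (intro isotropic_shift[OF affine_setD(4)[OF r(1)] _ _ rk]) (simp_all add: orth iso)
  then have rv: "r = u0 + v" using rk by simp
  then have "h r u0 = 0" by (simp add: orth)
  then have "vec.span {r} = vec.span {u0}"
    using noncollinear[OF affine_setD(1)[OF r(1)] u_in[of u0]] herm_collinear_span by auto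
  then obtain m where m: "r = m *s u0" using span_singleton_eq_imp by blast
  then have "h r p = m" by simp
  then have "m = 1" using affine_setD(2)[OF r(1)] by simp
  then show "v = 0" using m rv by simp
qed

text \<open>
The Gram matrix of \<open>w1\<close>, \<open>w2\<close>; its entries lie in \<open>F\<^sub>q\<close> and define the binary quadratic form
\<open>A s\<^sup>2 + 2 B s t + C t\<^sup>2\<close>.
\<close>

definition "A = h w1 w1"
definition "B = h w1 w2"
definition "C = h w2 w2"

lemma ABC [simp]:
  "h w1 w1 = A" "h w1 w2 = B" "h w2 w1 = B" "h w2 w2 = C" "cj A = A" "cj B = B" "cj C = C"
  using h_w_fixed[of u1 u1] h_w_fixed[of u1 u2] h_w_fixed[of u2 u2] h_swap[of w2 w1]
  by (simp_all add: A_def B_def C_def)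

lemma A_neq_0: "A \<noteq> 0"
  using anisotropic[of w1] w1_neq_0 by auto

text \<open>
If the discriminant \<open>B\<^sup>2 - A C\<close> were a square in \<open>F\<^sub>q\<close>, the binary form would factor over \<open>F\<^sub>q\<close> and the vector \<open>v\<close> below
would be isotropic.
\<close>

lemma no_fixed_discriminant_root:
  assumes "d\<^sup>2 = B\<^sup>2 - A * C" shows "cj d \<noteq> d"
proof
  assume d: "cj d = d"
  define v where "v = (d - B) *s w1 + A *s w2"
  have 1: "h v w1 = A * d" and 2: "h v w2 = (d - B) * B + A * C"
    by (simp_all add: v_def algebra_simps)
  have "h v v = A * (d\<^sup>2 - (B\<^sup>2 - A * C))"
    by (simp add: v_def d algebra_simps power2_eq_square)
  then have "v = 0" using assms
    by (intro anisotropic) (simp_all add: 1 2 d, simp_all add: v_def)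
  moreover have "A *s w2 = v + (B - d) *s w1" by (simp add: v_def vec4_eq_iff algebra_simps)
  ultimately have Aw2: "A *s w2 = (B - d) *s w1" by simp
  have "w2 = (1 / A) *s (A *s w2)" using A_neq_0 by simp
  also have "\<dots> = ((B - d) / A) *s w1" unfolding Aw2 vector_smult_assoc by simp
  finally have "w2 = ((B - d) / A) *s w1" .
  then show False using w_independent by blast
qed

text \<open>
Over \<open>F\<^sub>q\<close> an anisotropic binary form is a scalar multiple of the norm form of the quadratic extension.
Concretely, let \<open>d\<close> be a square root of the discriminant \<open>B\<^sup>2 - A C\<close>, so that \<open>cj d = - d\<close>, and replace
\<open>w2\<close> by \<open>b = A *s w2 - B *s w1\<close>, which is orthogonal to \<open>w1\<close> with \<open>h b b = - (A * d\<^sup>2)\<close>. The vectors \<open>(0, 1, 1, 0)\<close> and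
\<open>(0, d, -d, 0)\<close> have the same Gram matrix as \<open>w1\<close>, \<open>b\<close> up to the factor \<open>c = - 2 / A\<close>. The linear map \<open>f\<close> sending
\<open>w1\<close>, \<open>b\<close> to them, \<open>p\<close> to \<open>(0, 0, 0, 1)\<close> and \<open>u0\<close> to \<open>(c, 0, 0, 0)\<close> is therefore a similitude with factor \<open>c\<close>. For
\<open>r\<close> in the affine set the values \<open>h r w1\<close> and \<open>h r b\<close> lie in \<open>F\<^sub>q\<close>, which makes the two middle coordinates of \<open>f r\<close>
conjugate to each other; the last one lies in \<open>F\<^sub>q\<close>, so isotropy determines it, and \<open>f r\<close> spans a point of the
Veronesean.
\<close>

lemma herm_equivalent_veronesean: "herm_equivalent q S (herm_veronesean q)"
proof -
  have "cj (B\<^sup>2 - A * C) = B\<^sup>2 - A * C" by simp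
  then obtain d where d2: "d\<^sup>2 = B\<^sup>2 - A * C" using square_root_of_fixed by blast
  have dn: "cj d \<noteq> d" by (rule no_fixed_discriminant_root[OF d2])
  have "(cj d)\<^sup>2 = cj (d\<^sup>2)" by simp
  also have "\<dots> = d\<^sup>2" unfolding d2 by simp
  finally have "(cj d)\<^sup>2 = d\<^sup>2" .
  then have cjd: "cj d = - d" using dn by (simp add: power2_eq_iff)
  have d0: "d \<noteq> 0" using dn by auto
  note [simp] = A_neq_0 d0 cjd two_neq_0
  define b where "b = A *s w2 - B *s w1"
  have bw1: "h b w1 = 0" "h w1 b = 0" by (simp_all add: b_def)
  have bb: "h b b = - (A * d\<^sup>2)"
    unfolding d2 by (simp add: b_def algebra_simps power2_eq_square)
  have bp: "h b p = 0" "h b u0 = 0" "h p b = 0" "h u0 b = 0" by (simp_all add: b_def)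
  note [simp] = bw1 bb bp
  define c where "c = - 2 / A"
  have c: "c \<noteq> 0" "cj c = c" by (simp_all add: c_def)
  define f where "f x = coords4 (c * h x p) ((h x w1 - h x b / d) / A) ((h x w1 + h x b / d) / A) (h x u0)"
    for x
  \<comment> \<open>The expansion in the basis \<open>u0\<close>, \<open>p\<close>, \<open>w1\<close>, \<open>b\<close>.\<close>
  have expand: "x = h x p *s u0 + h x u0 *s p + (h x w1 / A) *s w1 + (- h x b / (A * d\<^sup>2)) *s b" for x
  proof -
    define y where "y = x - (h x p *s u0 + h x u0 *s p + (h x w1 / A) *s w1 + (- h x b / (A * d\<^sup>2)) *s b)"
    have y: "h y p = 0" "h y u0 = 0" "h y w1 = 0" by (simp_all add: y_def)
    have "h y b = 0" by (simp add: y_def)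
    then have "h y w2 = 0" using y by (simp add: b_def)
    then have "y = 0" using y by (intro eq_0_if_orthogonal)
    then show ?thesis by (simp add: y_def)
  qed
  have sim: "h (f x) (f y) = c * h x y" for x y
  proof -
    have "h x y = h x p * h u0 y + h x u0 * h p y + h x w1 * h w1 y / A - h x b * h b y / (A * d\<^sup>2)"
      by (subst expand[of x]) simp
    moreover have "h (f x) (f y) = c * h x p * h u0 y + c * h x u0 * h p y
        - 2 / A * (h x w1 * h w1 y / A) + 2 / A * (h x b * h b y / (A * d\<^sup>2))"
      by (simp add: f_def h_coords4 c h_swap[of u0 y] h_swap[of p y] h_swap[of w1 y] h_swap[of b y]
          field_simps power2_eq_square)
    ultimately show ?thesis by (simp only:) (simp add: c_def algebra_simps)
  qed
  let ?g = "restrict (image f) pg_points"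
  have scale: "f (k *s x) = k *s f x" for k x
    by (simp add: f_def vec4_eq_iff field_simps)
  have "f (x + y) = f x + f y" for x y
    by (simp add: f_def vec4_eq_iff field_simps)
  then have g: "?g \<in> PGammaU q" by (rule similitude_in_PGammaU[OF _ scale sim c(1)])
  have image_span: "f ` vec.span {x} = vec.span {f x}" for x
    by (simp add: vec.span_singleton image_image scale)
  have S_pg: "S \<subseteq> pg_points" using S_sub by (auto simp: herm_surface_def)
  have "?g X \<in> herm_veronesean q" if X: "X \<in> S" for X
  proof (cases "X = vec.span {p}")
    case True
    have "f p = coords4 0 0 0 1" by (simp add: f_def)
    then have "?g X = vec.span {coords4 0 0 0 1}" using True X S_pg image_span by auto
    then show ?thesis by (simp add: herm_veronesean_def)
  next
    case False
    then obtain r where r: "r \<in> affine_set" "X = vec.span {r}"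
      using bij_affine_set X by (auto simp: bij_betw_def)
    define x where "x = (h r w1 - h r b / d) / (A * c)"
    have "cj (h r b) = h r b" by (simp add: b_def h_affine_fixed[OF r(1)])
    then have cjx: "cj x = (h r w1 + h r b / d) / (A * c)"
      by (simp add: x_def c h_affine_fixed[OF r(1)])
    have fr: "f r = coords4 c (c * x) (c * cj x) (h r u0)"
      by (simp add: f_def cjx affine_setD[OF r(1)]) (simp add: x_def c)
    \<comment> \<open>This is \<open>h (f r) (f r) = 0\<close>.\<close>
    have "2 * (c * h r u0) = 2 * (c * (c * (x * cj x)))"
      using sim[of r r]
      by (simp add: affine_setD[OF r(1)] h_affine_fixed[OF r(1)] fr h_coords4 c algebra_simps)
    then have "h r u0 = c * (x * cj x)" using c by simp
    then have "f r = c *s coords4 1 x (x ^ q) (x ^ (q + 1))"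
      by (simp add: fr vec4_eq_iff cj_def)
    moreover have "vec.span {c *s y} = vec.span {y}" for y :: "'a ^ 4"
      using c(1) by (rule span_singleton_scale)
    ultimately have "?g X = vec.span {coords4 1 x (x ^ q) (x ^ (q + 1))}"
      using r(2) X S_pg image_span by auto
    then show ?thesis by (simp add: herm_veronesean_def)
  qed
  then have sub: "?g ` S \<subseteq> herm_veronesean q" by blast
  have "card (?g ` S) = card (herm_veronesean q :: ('a ^ 4) set set)"
  proof -
    have "herm_equivalent q S (?g ` S)" using g unfolding herm_equivalent_def by blast
    then show ?thesis
      using card_eq_if_herm_equivalent[OF _ S_pg] card_S_eq card_herm_veronesean by simp
  qed
  then have "?g ` S = herm_veronesean q" using sub by (intro card_subset_eq) simp_all
  then show ?thesis using g unfolding herm_equivalent_def by blast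
qed

end

section \<open>The characterisation\<close>

theorem theorem1p1:
  fixes q :: nat
    and S :: "('a::{field, finite} ^ 4) set set"
    and P :: "('a ^ 4) set"
    and Q :: "nat \<Rightarrow> ('a ^ 4) set"
  assumes "primepow q" and "odd q"
    and "CARD('a) = q\<^sup>2"
    and "S \<subseteq> herm_surface q"
    and "\<And>X Y. X \<in> S \<Longrightarrow> Y \<in> S \<Longrightarrow> X \<noteq> Y \<Longrightarrow> \<not> herm_collinear q X Y"
    and "P \<in> S" and "\<And>i. i \<in> {1, 2, 3} \<Longrightarrow> Q i \<in> S"
    and "\<not> pg_coplanar {P, Q 1, Q 2, Q 3}"
    and "\<And>i R. i \<in> {1, 2, 3} \<Longrightarrow> R \<in> S - {P, Q i} \<Longrightarrow> in_perspective q P (Q i) R"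
  shows "card S \<le> q\<^sup>2 + 1 \<and> (card S = q\<^sup>2 + 1 \<longleftrightarrow> herm_equivalent q S (herm_veronesean q))"
proof -
  interpret square_field q "TYPE('a)"
    using assms(1-3) by unfold_locales
  have S_sub: "S \<subseteq> herm_surface q" by fact
  have S_pg: "S \<subseteq> pg_points" using S_sub by (auto simp: herm_surface_def)
  define v where "v X = (SOME x :: 'a ^ 4. X = vec.span {x})" for X
  have v: "X = vec.span {v X}" if "X \<in> S" for X
  proof -
    have "\<exists>x. X = vec.span {x}" using S_pg that by (auto simp: pg_points_eq)
    then show ?thesis unfolding v_def by (rule someI_ex)
  qed
  define p where "p = v P"
  have p: "P = vec.span {p}" unfolding p_def using assms(6) by (rule v)
  define u where "u i = (SOME x. Q i = vec.span {x} \<and> h x p = 1)" for i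
  have u: "Q i = vec.span {u i}" "h (u i) p = 1" if i: "i \<in> {1, 2, 3}" for i
  proof -
    have "Q i \<noteq> P"
    proof
      \<comment> \<open>Coinciding points would leave at most three vectors to span the space.\<close>
      assume "Q i = P"
      have "Q 1 = vec.span {v (Q 1)}" "Q 2 = vec.span {v (Q 2)}" "Q 3 = vec.span {v (Q 3)}"
        by (rule v, rule assms(7), simp)+
      then have "vec.span {p, v (Q 1), v (Q 2), v (Q 3)} = UNIV"
        using assms(8) p by (intro span_UNIV_if_not_coplanar) metis
      then have "card {p, v (Q 1), v (Q 2), v (Q 3)} \<ge> 4"
        by (rule card_ge_4_if_span_UNIV) simp
      then show False using \<open>Q i = P\<close> i p_def by (auto simp: card_insert_if split: if_splits)
    qed
    then have "\<not> herm_collinear q (Q i) (vec.span {p})"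
      using assms(5)[OF assms(7)[OF i] assms(6)] p by simp
    moreover have "Q i \<in> herm_surface q" using S_sub assms(7)[OF i] by blast
    ultimately have "\<exists>x. Q i = vec.span {x} \<and> h x p = 1" by (intro ex_normalised_representative)
    from someI_ex[OF this] show "Q i = vec.span {u i}" "h (u i) p = 1" by (auto simp: u_def)
  qed
  have u_cases: "\<exists>i\<in>{1, 2, 3}. x = u i" if "x \<in> {u 3, u 1, u 2}" for x using that by blast
  interpret perspective_set q "TYPE('a)" S p "u 3" "u 1" "u 2"
  proof
    show "S \<subseteq> herm_surface q" by fact
    show "\<not> herm_collinear q X Y" if "X \<in> S" "Y \<in> S" "X \<noteq> Y" for X Y using that by (rule assms(5))
    show "vec.span {p} \<in> S" using assms(6) p by simp
    show "vec.span {x} \<in> S" if "x \<in> {u 3, u 1, u 2}" for x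
      using u_cases[OF that] u(1) assms(7) by metis
    show "h x p = 1" if "x \<in> {u 3, u 1, u 2}" for x using u_cases[OF that] u(2) by metis
    have "vec.span {p, u 1, u 2, u 3} = UNIV"
      using assms(8) p u(1) by (intro span_UNIV_if_not_coplanar) simp
    then show "vec.span {p, u 3, u 1, u 2} = UNIV" by (simp add: insert_commute)
    show "in_perspective q (vec.span {p}) (vec.span {x}) R"
      if "x \<in> {u 3, u 1, u 2}" "R \<in> S - {vec.span {p}, vec.span {x}}" for x R
      using u_cases[OF that(1)] that(2) u(1) assms(9) p by metis
  qed
  have "card S = q\<^sup>2 + 1" if "herm_equivalent q S (herm_veronesean q)"
    using card_eq_if_herm_equivalent[OF that S_pg] card_herm_veronesean by simp
  moreover have "herm_equivalent q S (herm_veronesean q)" if "card S = q\<^sup>2 + 1"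
  proof -
    interpret full_perspective_set q "TYPE('a)" S p "u 3" "u 1" "u 2"
      using that by unfold_locales
    show ?thesis by (rule herm_equivalent_veronesean)
  qed
  ultimately show ?thesis using card_S_le by blast
qed

end
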